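(* Let $A$ be a linear relation in a linear space $\mathfrak{H}$ over $\mathbb{C}$, let $\lambda_1,\ldots,\lambda_l\in\mathbb{C}$ be pairwise distinct, and let $\mu\in\mathbb{C}\cup\{\infty\}$ be such that the sets $\{\lambda_1,\ldots,\lambda_l\}$ and $\{\mu\}$ are disjoint. Assume that $$x^r\in\mathfrak{R}_{\lambda_r}(A),\quad r=1,\ldots,l,\qquad\text{and}\qquad \sum_{r=1}^l x^r\in\mathfrak{R}_\mu(A).$$ Then $x^r\in\mathfrak{R}_c(A)$ for $r=1,\ldots,l$.
   Context: Let $\mathfrak{H}$ be a (possibly infinite-dimensional) linear space over $\mathbb{C}$. A linear relation $A$ in $\mathfrak{H}$ is a linear subspace of $\mathfrak{H}\times\mathfrak{H}$. Put $\ker A=\{x: (x,0)\in A\}$, $\operatorname{mul}A=\{y:(0,y)\in A\}$. For $\lambda\in\mathbb{C}$, $A-\lambda=\{(x,y-\lambda x):(x,y)\in A\}$. The product of linear relations is $AB=\{(x,y): \exists z\in\mathfrak{H},\ (x,z)\in B,\ (z,y)\in A\}$, and $A^k=AA^{k-1}$ for $k\ge1$ with $A^0=I$. The root spaces are the linear subspaces $$\mathfrak{R}_\lambda(A)=\bigcup_{i=1}^\infty\ker(A-\lambda)^i\ (\lambda\in\mathbb{C}),\qquad \mathfrak{R}_\infty(A)=\bigcup_{i=1}^\infty\operatorname{mul}A^i,$$ and the singular chain space is $\mathfrak{R}_c(A)=\mathfrak{R}_0(A)\cap\mathfrak{R}_\infty(A)$. Superscripts in $x^r$ are indices, not powers.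 *)

theory Defs
  imports "HOL-Analysis.Product_Vector"
begin

text \<open>The linear space is a type \<^typ>\<open>'a::ab_group_add\<close> with an arbitrary complex scalar
  multiplication \<open>smul\<close> that satisfies \<^const>\<open>vector_space\<close>; it carries no norm and no
  dimension restriction.\<close>

definition linear_relation ::
    "(complex \<Rightarrow> 'a::ab_group_add \<Rightarrow> 'a) \<Rightarrow> ('a \<times> 'a) set \<Rightarrow> bool" where
  "linear_relation smul A \<longleftrightarrow> module.subspace (module_prod.scale smul smul) A"

lemma linear_relation_iff:
  assumes "vector_space smul"
  shows "linear_relation smul A \<longleftrightarrow> (0, 0) \<in> A
    \<and> (\<forall>x y u v. (x, y) \<in> A \<longrightarrow> (u, v) \<in> A \<longrightarrow> (x + u, y + v) \<in> A)
    \<and> (\<forall>c x y. (x, y) \<in> A \<longrightarrow> (smul c x, smul c y) \<in> A)"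
proof -
  interpret V: vector_space smul by fact
  interpret P: vector_space_prod smul smul by unfold_locales
  show ?thesis
    unfolding linear_relation_def P.p.subspace_def
    by (simp add: P.scale_prod zero_prod_def Ball_def split_paired_All)
qed

definition rel_ker :: "('a::ab_group_add \<times> 'a) set \<Rightarrow> 'a set" where
  "rel_ker A = {x. (x, 0) \<in> A}"

definition rel_mul :: "('a::ab_group_add \<times> 'a) set \<Rightarrow> 'a set" where
  "rel_mul A = {y. (0, y) \<in> A}"

definition rel_shift ::
    "(complex \<Rightarrow> 'a::ab_group_add \<Rightarrow> 'a) \<Rightarrow> ('a \<times> 'a) set \<Rightarrow> complex \<Rightarrow> ('a \<times> 'a) set" where
  "rel_shift smul A c = {(x, y - smul c x) | x y. (x, y) \<in> A}"

datatype ext_complex = Finite complex | Infinity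

text \<open>The operator product \<open>A B\<close> of linear relations is \<open>B O A\<close>, because \<^const>\<open>relcomp\<close>
  applies its left argument first.  Hence \<open>A\<^sup>k = A A\<^sup>k\<^sup>-\<^sup>1\<close>, \<open>A\<^sup>0 = I\<close> is the defining recursion
  of the library power \<open>A ^^ k\<close>.\<close>

fun root_space ::
    "(complex \<Rightarrow> 'a::ab_group_add \<Rightarrow> 'a) \<Rightarrow> ('a \<times> 'a) set \<Rightarrow> ext_complex \<Rightarrow> 'a set" where
  "root_space smul A (Finite c) = (\<Union>i\<in>{1..}. rel_ker (rel_shift smul A c ^^ i))"
| "root_space smul A Infinity = (\<Union>i\<in>{1..}. rel_mul (A ^^ i))"

definition singular_chain_space ::
    "(complex \<Rightarrow> 'a::ab_group_add \<Rightarrow> 'a) \<Rightarrow> ('a \<times> 'a) set \<Rightarrow> 'a set" where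
  "singular_chain_space smul A =
     root_space smul A (Finite 0) \<inter> root_space smul A Infinity"

end

theory Submission
  imports Defs
begin

text \<open>Write \<open>R\<^sub>\<lambda>\<close> for the root space at \<open>\<lambda>\<close>.  The space \<open>R\<^sub>\<infinity>\<close> contains the multivalued part of \<open>A\<close>
  and is mapped into itself by \<open>A\<close>.  Hence \<open>A\<close> induces on the quotient by \<open>R\<^sub>\<infinity>\<close> a single-valued,
  partially defined operator, and for operators the root spaces at distinct eigenvalues are
  linearly independent.  So if root vectors \<open>x\<^sup>r\<close> at distinct eigenvalues have their sum in
  \<open>R\<^sub>\<infinity>\<close>, then each of them lies in \<open>R\<^sub>\<infinity>\<close>; this is \<open>root_spaces_independent_mod_infinity\<close>, whose
  proof is the classical one and computes with representatives instead of cosets.  A finite \<open>\<mu>\<close> is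
  no different: the negative of the sum of the \<open>x\<^sup>r\<close> is then one more vector, at the further
  eigenvalue \<open>\<mu>\<close>, and makes the sum zero.

  It remains to pass from \<open>R\<^sub>\<lambda> \<inter> R\<^sub>\<infinity>\<close> to \<open>R\<^sub>0 \<inter> R\<^sub>\<infinity>\<close>, that is, to see that inside \<open>R\<^sub>\<infinity>\<close> the
  eigenvalue is immaterial.  This is \<open>root_space_change_eigenvalue\<close>.  It rests on the fact that a
  chain that leads from \<open>0\<close> to \<open>x\<close> may be re-weighted so that its last step is a step of \<open>A - \<nu>\<close> for any
  prescribed \<open>\<nu>\<close> (\<open>mul_power_preimage\<close>).\<close>

section \<open>Powers and shifts of linear relations\<close>

declare root_space.simps [simp del]

lemma rel_mul_power_Suc: "y \<in> rel_mul (B ^^ Suc m) \<longleftrightarrow> (\<exists>w \<in> rel_mul (B ^^ m). (w, y) \<in> B)"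
  by (auto simp: rel_mul_def)

lemma rel_ker_power_Suc: "x \<in> rel_ker (B ^^ Suc n) \<longleftrightarrow> (\<exists>y \<in> rel_ker (B ^^ n). (x, y) \<in> B)"
proof -
  have "B ^^ Suc n = B O B ^^ n" by (simp add: relpow_commute)
  then show ?thesis by (auto simp: rel_ker_def)
qed

lemma rel_mul_power_SucI: "w \<in> rel_mul (B ^^ m) \<Longrightarrow> (w, y) \<in> B \<Longrightarrow> y \<in> rel_mul (B ^^ Suc m)"
  unfolding rel_mul_power_Suc by blast

lemma rel_mul_power_SucE:
  assumes "y \<in> rel_mul (B ^^ Suc m)"
  obtains w where "w \<in> rel_mul (B ^^ m)" "(w, y) \<in> B"
  using assms unfolding rel_mul_power_Suc by blast

lemma rel_ker_power_SucI: "y \<in> rel_ker (B ^^ n) \<Longrightarrow> (x, y) \<in> B \<Longrightarrow> x \<in> rel_ker (B ^^ Suc n)"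
  unfolding rel_ker_power_Suc by blast

lemma rel_ker_power_conv_rel_mul: "rel_ker (B ^^ n) = rel_mul ((B\<inverse>) ^^ n)"
proof -
  have "x \<in> rel_ker (B ^^ n) \<longleftrightarrow> x \<in> rel_mul ((B\<inverse>) ^^ n)" for x
  proof (induction n arbitrary: x)
    case 0
    show ?case by (auto simp: rel_ker_def rel_mul_def)
  next
    case (Suc n)
    then show ?case unfolding rel_ker_power_Suc rel_mul_power_Suc by auto
  qed
  then show ?thesis by blast
qed

locale linear_relation_space = vector_space smul
  for smul :: "complex \<Rightarrow> 'a::ab_group_add \<Rightarrow> 'a" +
  fixes A :: "('a \<times> 'a) set"
  assumes linear: "linear_relation smul A"
begin

lemma linear_iff:
  "linear_relation smul B \<longleftrightarrow> (0, 0) \<in> B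
    \<and> (\<forall>x y u v. (x, y) \<in> B \<longrightarrow> (u, v) \<in> B \<longrightarrow> (x + u, y + v) \<in> B)
    \<and> (\<forall>c x y. (x, y) \<in> B \<longrightarrow> (smul c x, smul c y) \<in> B)"
  by (rule linear_relation_iff) (rule vector_space_axioms)

lemma linear_converse: "linear_relation smul B \<Longrightarrow> linear_relation smul (B\<inverse>)"
  unfolding linear_iff by blast

lemma rel_shift_iff: "(x, y) \<in> rel_shift smul A c \<longleftrightarrow> (x, y + smul c x) \<in> A"
  unfolding rel_shift_def by (auto simp: eq_diff_eq)

lemma linear_shift: "linear_relation smul (rel_shift smul A c)"
proof -
  have add: "y + v + smul c (x + u) = (y + smul c x) + (v + smul c u)" for x y u v
    by (simp add: scale_right_distrib algebra_simps)
  have scl: "smul d y + smul c (smul d x) = smul d (y + smul c x)" for d x y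
    by (simp add: scale_right_distrib mult.commute)
  show ?thesis
    using linear unfolding linear_iff rel_shift_iff add scl by simp
qed

lemma linear_zero: "linear_relation smul B \<Longrightarrow> (0, 0) \<in> B"
  by (simp add: linear_iff)

lemma linear_add:
  "linear_relation smul B \<Longrightarrow> (x, y) \<in> B \<Longrightarrow> (u, v) \<in> B \<Longrightarrow> (x + u, y + v) \<in> B"
  by (simp add: linear_iff)

lemma linear_scale: "linear_relation smul B \<Longrightarrow> (x, y) \<in> B \<Longrightarrow> (smul c x, smul c y) \<in> B"
  by (simp add: linear_iff)

lemmas zero_mem = linear_zero[OF linear]
  and add_mem = linear_add[OF linear]
  and scale_mem = linear_scale[OF linear]

lemma sum_mem:
  assumes "\<And>i. i \<in> I \<Longrightarrow> (f i, g i) \<in> A"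
  shows "(\<Sum>i\<in>I. f i, \<Sum>i\<in>I. g i) \<in> A"
  using assms by (induction I rule: infinite_finite_induct) (auto simp: zero_mem add_mem)

section \<open>Root spaces as increasing unions of subspaces\<close>

lemma subspace_rel_mul_power:
  assumes "linear_relation smul B"
  shows "subspace (rel_mul (B ^^ m))"
proof (induction m)
  case 0
  have "rel_mul (B ^^ 0) = {0}" by (auto simp: rel_mul_def)
  then show ?case by simp
next
  case (Suc m)
  show ?case
    unfolding subspace_def rel_mul_power_Suc
  proof (intro conjI ballI allI)
    show "\<exists>w\<in>rel_mul (B ^^ m). (w, 0) \<in> B"
      using linear_zero[OF assms] subspace_0[OF Suc.IH] by blast
  next
    fix x y
    assume "x \<in> rel_mul (B ^^ Suc m)" "y \<in> rel_mul (B ^^ Suc m)"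
    then obtain u v where "u \<in> rel_mul (B ^^ m)" "(u, x) \<in> B" "v \<in> rel_mul (B ^^ m)" "(v, y) \<in> B"
      unfolding rel_mul_power_Suc by blast
    then have "u + v \<in> rel_mul (B ^^ m)" "(u + v, x + y) \<in> B"
      by (simp_all add: subspace_add[OF Suc.IH] linear_add[OF assms])
    then show "\<exists>w\<in>rel_mul (B ^^ m). (w, x + y) \<in> B" by blast
  next
    fix c x
    assume "x \<in> rel_mul (B ^^ Suc m)"
    then obtain u where "u \<in> rel_mul (B ^^ m)" "(u, x) \<in> B"
      unfolding rel_mul_power_Suc by blast
    then have "smul c u \<in> rel_mul (B ^^ m)" "(smul c u, smul c x) \<in> B"
      by (simp_all add: subspace_scale[OF Suc.IH] linear_scale[OF assms])
    then show "\<exists>w\<in>rel_mul (B ^^ m). (w, smul c x) \<in> B" by blast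
  qed
qed

lemma rel_mul_power_mono:
  assumes "linear_relation smul B" and "m \<le> n"
  shows "rel_mul (B ^^ m) \<subseteq> rel_mul (B ^^ n)"
proof (rule lift_Suc_mono_le[OF _ \<open>m \<le> n\<close>])
  fix k
  show "rel_mul (B ^^ k) \<subseteq> rel_mul (B ^^ Suc k)"
  proof (induction k)
    case 0
    have "rel_mul (B ^^ 0) = {0}" by (auto simp: rel_mul_def)
    show ?case
      using subspace_0[OF subspace_rel_mul_power[OF assms(1), of "Suc 0"]]
      unfolding \<open>rel_mul (B ^^ 0) = {0}\<close> by blast
  next
    case (Suc k)
    show ?case
    proof
      fix y
      assume "y \<in> rel_mul (B ^^ Suc k)"
      then obtain w where "w \<in> rel_mul (B ^^ k)" "(w, y) \<in> B"
        by (rule rel_mul_power_SucE)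
      then show "y \<in> rel_mul (B ^^ Suc (Suc k))"
        using Suc.IH by (blast intro: rel_mul_power_SucI)
    qed
  qed
qed

lemma subspace_Union_rel_mul_power:
  assumes "linear_relation smul B"
  shows "subspace (\<Union>m. rel_mul (B ^^ m))"
proof (rule subspaceI)
  note sub = subspace_rel_mul_power[OF assms]
  show "0 \<in> (\<Union>m. rel_mul (B ^^ m))"
    using subspace_0[OF sub] by blast
  show "smul c x \<in> (\<Union>m. rel_mul (B ^^ m))" if "x \<in> (\<Union>m. rel_mul (B ^^ m))" for c x
    using that subspace_scale[OF sub] by blast
  show "x + y \<in> (\<Union>m. rel_mul (B ^^ m))"
    if xy: "x \<in> (\<Union>m. rel_mul (B ^^ m))" "y \<in> (\<Union>m. rel_mul (B ^^ m))" for x y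
  proof -
    obtain m n where "x \<in> rel_mul (B ^^ m)" "y \<in> rel_mul (B ^^ n)"
      using xy by blast
    then have "x \<in> rel_mul (B ^^ max m n)" "y \<in> rel_mul (B ^^ max m n)"
      using rel_mul_power_mono[OF assms] by (meson max.cobounded1 max.cobounded2 subsetD)+
    then show ?thesis
      using subspace_add[OF sub] by blast
  qed
qed

text \<open>The exponent \<open>0\<close> may be included in the unions, which makes it available as the base case
  of inductions along a chain.\<close>

lemma Union_rel_mul_power_from_1:
  assumes "linear_relation smul B"
  shows "(\<Union>m\<in>{1..}. rel_mul (B ^^ m)) = (\<Union>m. rel_mul (B ^^ m))"
proof (rule antisym)
  show "(\<Union>m. rel_mul (B ^^ m)) \<subseteq> (\<Union>m\<in>{1..}. rel_mul (B ^^ m))"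
  proof (rule UN_least)
    fix m
    have "rel_mul (B ^^ m) \<subseteq> rel_mul (B ^^ Suc m)"
      by (rule rel_mul_power_mono[OF assms]) simp
    also have "\<dots> \<subseteq> (\<Union>m\<in>{1..}. rel_mul (B ^^ m))"
      by (rule UN_upper) simp
    finally show "rel_mul (B ^^ m) \<subseteq> (\<Union>m\<in>{1..}. rel_mul (B ^^ m))" .
  qed
qed blast

lemma root_space_Infinity: "root_space smul A Infinity = (\<Union>m. rel_mul (A ^^ m))"
  unfolding root_space.simps by (rule Union_rel_mul_power_from_1[OF linear])

lemma root_space_Finite:
  "root_space smul A (Finite c) = (\<Union>n. rel_ker (rel_shift smul A c ^^ n))"
  unfolding root_space.simps rel_ker_power_conv_rel_mul
  by (rule Union_rel_mul_power_from_1[OF linear_converse[OF linear_shift]])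

lemma subspace_root_space: "subspace (root_space smul A mu)"
proof (cases mu)
  case Infinity
  then show ?thesis
    unfolding Infinity root_space_Infinity by (intro subspace_Union_rel_mul_power linear)
next
  case (Finite c)
  then show ?thesis
    unfolding Finite root_space_Finite rel_ker_power_conv_rel_mul
    by (intro subspace_Union_rel_mul_power linear_converse linear_shift)
qed

text \<open>Extending a chain that starts at \<open>0\<close> by one step yields another such chain.  This is what
  makes \<open>A\<close> an operator modulo \<open>R\<^sub>\<infinity>\<close>.\<close>

lemma root_space_Infinity_step:
  assumes "x \<in> root_space smul A Infinity" and "(x, y + smul c x) \<in> A"
  shows "y \<in> root_space smul A Infinity"
proof -
  have "y + smul c x \<in> root_space smul A Infinity"
    using assms unfolding root_space_Infinity by (blast intro: rel_mul_power_SucI)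
  moreover have "smul c x \<in> root_space smul A Infinity"
    using assms(1) subspace_root_space by (rule subspace_scale[rotated])
  ultimately show ?thesis
    using subspace_diff[OF subspace_root_space] by fastforce
qed

text \<open>Conversely, a chain of \<open>A - c\<close> that ends at \<open>0\<close> may be extended at its front.\<close>

lemma root_space_Finite_back:
  assumes "y \<in> root_space smul A (Finite c)" and "(x, y + smul c x) \<in> A"
  shows "x \<in> root_space smul A (Finite c)"
  using assms unfolding root_space_Finite rel_shift_iff[symmetric]
  by (blast intro: rel_ker_power_SucI)

lemma root_space_Finite_front:
  assumes "x \<in> root_space smul A (Finite c)"
  obtains y where "y \<in> root_space smul A (Finite c)" "(x, y + smul c x) \<in> A"
proof -
  obtain n where "x \<in> rel_ker (rel_shift smul A c ^^ Suc n)"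
    using assms by (auto simp: root_space.simps Suc_le_eq gr0_conv_Suc simp del: relpow.simps)
  then show ?thesis
    using that unfolding root_space_Finite rel_ker_power_Suc rel_shift_iff by blast
qed

section \<open>Changing the eigenvalue inside the root space at infinity\<close>

text \<open>If \<open>s\<^sub>0 = 0, s\<^sub>1, \<dots>, s\<^sub>m\<^sub>+\<^sub>1 = x\<close> is a chain of \<open>A\<close>, the witness is the weighted sum
  \<open>\<Sum> \<nu>\<^sup>m\<^sup>-\<^sup>i s\<^sub>i\<close> over \<open>i \<le> m\<close>: by telescoping \<open>A - \<nu>\<close> takes it to \<open>x\<close>, just as
  \<open>(t - \<nu>) \<Sum> \<nu>\<^sup>m\<^sup>-\<^sup>i t\<^sup>i = t\<^sup>m\<^sup>+\<^sup>1 - \<nu>\<^sup>m\<^sup>+\<^sup>1\<close>.\<close>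

lemma mul_power_preimage:
  assumes "x \<in> rel_mul (A ^^ Suc m)"
  obtains h where "h \<in> rel_mul (A ^^ m)" "(h, x + smul nu h) \<in> A"
proof -
  have "\<exists>h \<in> rel_mul (A ^^ m). (h, x + smul nu h) \<in> A"
    using assms
  proof (induction m arbitrary: x)
    case 0
    then show ?case by (auto simp: rel_mul_def)
  next
    case (Suc m)
    obtain w where w: "w \<in> rel_mul (A ^^ Suc m)" "(w, x) \<in> A"
      using Suc.prems by (rule rel_mul_power_SucE)
    obtain h where h: "h \<in> rel_mul (A ^^ m)" "(h, w + smul nu h) \<in> A"
      using Suc.IH[OF w(1)] by blast
    have "w + smul nu h \<in> rel_mul (A ^^ Suc m)"
      using h by (rule rel_mul_power_SucI)
    moreover have "(w + smul nu h, x + smul nu (w + smul nu h)) \<in> A"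
      using add_mem[OF w(2) scale_mem[OF h(2)]] .
    ultimately show ?case by blast
  qed
  then show ?thesis using that by blast
qed

text \<open>Membership in \<open>R\<^sub>\<nu>\<close> propagates backwards along steps of \<open>A - c\<close> for any \<open>c\<close>, provided that
  the chain started at \<open>0\<close>.\<close>

lemma root_space_Finite_back_shifted:
  assumes "x \<in> rel_mul (A ^^ m)" and "(x, y + smul c x) \<in> A"
    and "y \<in> root_space smul A (Finite nu)"
  shows "x \<in> root_space smul A (Finite nu)"
  using assms
proof (induction m arbitrary: x y)
  case 0
  then have "x = 0" by (simp add: rel_mul_def)
  then show ?case using subspace_0[OF subspace_root_space] by simp
next
  case (Suc m)
  obtain h where h: "h \<in> rel_mul (A ^^ m)" "(h, x + smul nu h) \<in> A"
    using Suc.prems(1) by (rule mul_power_preimage)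
  \<comment> \<open>The coefficient of \<open>h\<close> is chosen such that \<open>g\<close> is at once a preimage of \<open>y\<close> under \<open>A - \<nu>\<close> and
    an image of \<open>h\<close> under \<open>A - c\<close>.\<close>
  define g where "g = x + smul (nu - c) h"
  have image: "y + smul c x + smul (nu - c) (x + smul nu h) = y + smul nu g"
    by (simp add: g_def scale_right_distrib scale_left_diff_distrib scale_right_diff_distrib
        algebra_simps)
  have "(g, y + smul nu g) \<in> A"
    using add_mem[OF Suc.prems(2) scale_mem[OF h(2), of "nu - c"]] unfolding image g_def[symmetric] .
  then have g: "g \<in> root_space smul A (Finite nu)"
    using Suc.prems(3) root_space_Finite_back by blast
  have "x + smul nu h = g + smul c h"
    by (simp add: g_def scale_left_diff_distrib)
  then have "h \<in> root_space smul A (Finite nu)"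
    using Suc.IH[OF h(1) _ g] h(2) by simp
  then have "g - smul (nu - c) h \<in> root_space smul A (Finite nu)"
    by (intro subspace_diff[OF subspace_root_space] g subspace_scale[OF subspace_root_space])
  then show ?case by (simp add: g_def)
qed

lemma root_space_change_eigenvalue:
  assumes "x \<in> root_space smul A (Finite c)" and "x \<in> root_space smul A Infinity"
  shows "x \<in> root_space smul A (Finite nu)"
proof -
  obtain n where "x \<in> rel_ker (rel_shift smul A c ^^ n)"
    using assms(1) root_space_Finite by blast
  then show ?thesis
    using assms(2)
  proof (induction n arbitrary: x)
    case 0
    then have "x = 0" by (simp add: rel_ker_def)
    then show ?case using subspace_0[OF subspace_root_space] by simp
  next
    case (Suc n)
    obtain y where y: "y \<in> rel_ker (rel_shift smul A c ^^ n)" "(x, y + smul c x) \<in> A"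
      using Suc.prems(1) unfolding rel_ker_power_Suc rel_shift_iff by blast
    have "y \<in> root_space smul A (Finite nu)"
      using Suc.IH[OF y(1)] root_space_Infinity_step[OF Suc.prems(2) y(2)] .
    then show ?case
      using root_space_Finite_back_shifted[OF _ y(2)] Suc.prems(2) root_space_Infinity by blast
  qed
qed

section \<open>Independence of the root spaces modulo the root space at infinity\<close>

text \<open>Modulo \<open>R\<^sub>\<infinity>\<close> the operator \<open>A - c\<close> is nilpotent on the chain through \<open>x\<close>, so \<open>A - c + \<kappa>\<close> is
  injective there when \<open>\<kappa> \<noteq> 0\<close>.\<close>

lemma shift_nonroot_cancel:
  assumes "y \<in> root_space smul A (Finite c)" and "kappa \<noteq> 0"
    and "y + smul kappa x \<in> root_space smul A Infinity" and "(x, y + smul c x) \<in> A"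
  shows "x \<in> root_space smul A Infinity"
proof -
  note R = subspace_root_space[of Infinity]
  have cancel: "x \<in> root_space smul A Infinity"
    if "y \<in> root_space smul A Infinity" "y + smul kappa x \<in> root_space smul A Infinity" for x y
  proof -
    have "smul kappa x \<in> root_space smul A Infinity"
      using subspace_diff[OF R that(2) that(1)] by simp
    then have "smul (inverse kappa) (smul kappa x) \<in> root_space smul A Infinity"
      by (rule subspace_scale[OF R])
    then show ?thesis using \<open>kappa \<noteq> 0\<close> by simp
  qed
  obtain n where "y \<in> rel_ker (rel_shift smul A c ^^ n)"
    using assms(1) root_space_Finite by blast
  then show ?thesis
    using assms(3,4)
  proof (induction n arbitrary: x y)
    case 0
    then have "y = 0" by (simp add: rel_ker_def)
    then show ?case using cancel[of y x] 0 subspace_0[OF R] by simp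
  next
    case (Suc n)
    obtain z where z: "z \<in> rel_ker (rel_shift smul A c ^^ n)" "(y, z + smul c y) \<in> A"
      using Suc.prems(1) unfolding rel_ker_power_Suc rel_shift_iff by blast
    have image: "z + smul c y + smul kappa (y + smul c x)
        = (z + smul kappa y) + smul c (y + smul kappa x)"
      by (simp add: scale_right_distrib algebra_simps)
    have "(y + smul kappa x, (z + smul kappa y) + smul c (y + smul kappa x)) \<in> A"
      using add_mem[OF z(2) scale_mem[OF Suc.prems(3), of kappa]] unfolding image .
    then have "z + smul kappa y \<in> root_space smul A Infinity"
      using root_space_Infinity_step Suc.prems(2) by blast
    then have "y \<in> root_space smul A Infinity"
      using Suc.IH z by blast
    then show ?case using cancel Suc.prems(2) by blast
  qed
qed

text \<open>As for operators, \<open>A - \<lambda>\<^sub>a\<close> is applied to all vectors: this shortens the chain of the vector at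
  \<open>a\<close>, and by the preceding lemma the vectors at the other eigenvalues can be recovered.\<close>

theorem root_spaces_independent_mod_infinity:
  assumes "finite I" and "inj_on lam I"
    and "\<And>r. r \<in> I \<Longrightarrow> x r \<in> root_space smul A (Finite (lam r))"
    and "(\<Sum>r\<in>I. x r) \<in> root_space smul A Infinity"
    and "r \<in> I"
  shows "x r \<in> root_space smul A Infinity"
  using assms
proof (induction I arbitrary: x r rule: finite_induct)
  case empty
  then show ?case by simp
next
  case (insert a I)
  note R = subspace_root_space[of Infinity]
  have inj: "inj_on lam I" using insert.prems(1) by simp
  obtain n where "x a \<in> rel_ker (rel_shift smul A (lam a) ^^ n)"
    using insert.prems(2)[of a] root_space_Finite by blast
  then show ?case
    using insert.prems(2-4)
  proof (induction n arbitrary: x r)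
    case 0
    then have xa: "x a = 0" by (simp add: rel_ker_def)
    then have "(\<Sum>r\<in>I. x r) \<in> root_space smul A Infinity"
      using 0 insert.hyps by simp
    then have "\<forall>r\<in>I. x r \<in> root_space smul A Infinity"
      using insert.IH[OF inj] 0 by blast
    then show ?case using xa subspace_0[OF R] 0 by auto
  next
    case (Suc n)
    let ?Y = "\<lambda>r y. y \<in> root_space smul A (Finite (lam r)) \<and> (x r, y + smul (lam r) (x r)) \<in> A
      \<and> (r = a \<longrightarrow> y \<in> rel_ker (rel_shift smul A (lam a) ^^ n))"
    have "\<exists>y. ?Y r y" if "r \<in> insert a I" for r
    proof (cases "r = a")
      case True
      then show ?thesis
        using Suc.prems(1) unfolding rel_ker_power_Suc rel_shift_iff root_space_Finite by blast
    next
      case False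
      then show ?thesis using root_space_Finite_front[OF Suc.prems(2)[OF that]] by metis
    qed
    then obtain y where y: "\<And>r. r \<in> insert a I \<Longrightarrow> ?Y r (y r)" by metis
    \<comment> \<open>\<open>v r\<close> is an image of \<open>x r\<close> under \<open>A - \<lambda>\<^sub>a\<close>.\<close>
    define v where "v r = y r + smul (lam r - lam a) (x r)" for r
    have va: "v a = y a" by (simp add: v_def)
    have v: "v r \<in> root_space smul A (Finite (lam r))" if "r \<in> insert a I" for r
      unfolding v_def using y[OF that] Suc.prems(2)[OF that]
      by (blast intro: subspace_add[OF subspace_root_space] subspace_scale[OF subspace_root_space])
    have "y r + smul (lam r) (x r) = v r + smul (lam a) (x r)" for r
      by (simp add: v_def scale_left_diff_distrib)
    then have "(x r, v r + smul (lam a) (x r)) \<in> A" if "r \<in> insert a I" for r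
      using y[OF that] by simp
    then have "(\<Sum>r\<in>insert a I. x r, \<Sum>r\<in>insert a I. v r + smul (lam a) (x r)) \<in> A"
      by (rule sum_mem)
    then have "(\<Sum>r\<in>insert a I. x r,
        (\<Sum>r\<in>insert a I. v r) + smul (lam a) (\<Sum>r\<in>insert a I. x r)) \<in> A"
      unfolding sum.distrib scale_sum_right .
    then have sum_v: "(\<Sum>r\<in>insert a I. v r) \<in> root_space smul A Infinity"
      by (rule root_space_Infinity_step[OF Suc.prems(3)])
    have v_inf: "v r \<in> root_space smul A Infinity" if "r \<in> insert a I" for r
    proof (rule Suc.IH[OF _ v sum_v that])
      show "v a \<in> rel_ker (rel_shift smul A (lam a) ^^ n)"
        using y[of a] va by simp
    qed
    have x_I: "x r \<in> root_space smul A Infinity" if "r \<in> I" for r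
    proof (rule shift_nonroot_cancel)
      show "lam r - lam a \<noteq> 0"
        using that insert.prems(1) insert.hyps(2) by (auto simp: inj_on_def)
      show "y r + smul (lam r - lam a) (x r) \<in> root_space smul A Infinity"
        using v_inf that unfolding v_def by blast
      show "y r \<in> root_space smul A (Finite (lam r))" "(x r, y r + smul (lam r) (x r)) \<in> A"
        using y that by blast+
    qed
    have "(\<Sum>r\<in>insert a I. x r) - (\<Sum>r\<in>I. x r) \<in> root_space smul A Infinity"
      by (intro subspace_diff[OF R] Suc.prems(3) subspace_sum[OF R] x_I)
    then have "x a \<in> root_space smul A Infinity"
      using insert.hyps by simp
    then show ?case using x_I Suc.prems(4) by blast
  qed
qed

end

section \<open>Root vectors whose sum is a root vector\<close>

theorem theorem4p4:
  fixes smul :: "complex \<Rightarrow> 'a::ab_group_add \<Rightarrow> 'a"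
    and A :: "('a \<times> 'a) set"
    and l :: nat
    and lam :: "nat \<Rightarrow> complex"
    and mu :: ext_complex
    and x :: "nat \<Rightarrow> 'a"
  assumes "vector_space smul"
    and "linear_relation smul A"
    and "inj_on lam {1..l}"
    and "(\<lambda>r. Finite (lam r)) ` {1..l} \<inter> {mu} = {}"
    and "\<And>r. r \<in> {1..l} \<Longrightarrow> x r \<in> root_space smul A (Finite (lam r))"
    and "(\<Sum>r=1..l. x r) \<in> root_space smul A mu"
  shows "\<forall>r\<in>{1..l}. x r \<in> singular_chain_space smul A"
proof -
  interpret linear_relation_space smul A
    using assms(1,2) by (simp add: linear_relation_space_def linear_relation_space_axioms_def)
  have "x r \<in> root_space smul A Infinity" if r: "r \<in> {1..l}" for r
  proof (cases mu)
    case Infinity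
    then show ?thesis
      using root_spaces_independent_mod_infinity[of "{1..l}" lam x] assms(3,5,6) r by simp
  next
    case (Finite c)
    \<comment> \<open>The index \<open>0\<close> is free and receives the eigenvalue \<open>\<mu>\<close> and the vector that makes the sum zero.\<close>
    define lam' where "lam' = lam(0 := c)"
    define x' where "x' = x(0 := - (\<Sum>r=1..l. x r))"
    have agree: "lam' i = lam i" "x' i = x i" if "i \<in> {1..l}" for i
      using that by (auto simp: lam'_def x'_def)
    have "c \<notin> lam ` {1..l}"
      using assms(4) Finite by auto
    moreover have "lam' ` {1..l} = lam ` {1..l}"
      using agree(1) by (rule image_cong[OF refl])
    moreover have "inj_on lam' {1..l} \<longleftrightarrow> inj_on lam {1..l}"
      using agree(1) by (rule inj_on_cong)
    moreover have "lam' 0 = c"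
      by (simp add: lam'_def)
    ultimately have inj: "inj_on lam' (insert 0 {1..l})"
      using assms(3) unfolding inj_on_insert by blast
    have "x' i \<in> root_space smul A (Finite (lam' i))" if "i \<in> insert 0 {1..l}" for i
    proof (cases "i = 0")
      case True
      then show ?thesis
        using subspace_neg[OF subspace_root_space assms(6)] Finite
        by (simp add: lam'_def x'_def)
    next
      case False
      then have "i \<in> {1..l}" using that by blast
      then show ?thesis using assms(5) agree by simp
    qed
    moreover have "(\<Sum>i\<in>insert 0 {1..l}. x' i) = x' 0 + (\<Sum>i=1..l. x i)"
      using agree by simp
    then have "(\<Sum>i\<in>insert 0 {1..l}. x' i) \<in> root_space smul A Infinity"
      using subspace_0[OF subspace_root_space] by (simp add: x'_def)
    ultimately have "x' r \<in> root_space smul A Infinity"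
      using root_spaces_independent_mod_infinity[OF _ inj] r by blast
    then show ?thesis using agree r by simp
  qed
  then show ?thesis
    unfolding singular_chain_space_def using root_space_change_eigenvalue assms(5) by blast
qed

end
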